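(* Fix $\tfrac12<\beta<1$ and real model parameters $\nu,\rho$ (with $|\rho|\le1$), and consider the SABR model $$dX_1(t,x)=X_2(t,x)\,X_1(t,x)_+^{\beta}\,dB^1(t),\qquad dX_2(t,x)=\nu X_2(t,x)\big(\rho\,dB^1(t)+\sqrt{1-\rho^2}\,dB^2(t)\big),$$ where $x_+=x\vee0$. Let $\{W_n;\,n\ge0\}$ be the set of vector fields on $\mathbf{R}^2$ defined by $$W_n=\frac{1}{1-\beta}\,(x_1)_+^{1-n(1-\beta)}\,x_2^{n}\,\frac{\partial}{\partial x_1}\quad(n\ge1),\qquad W_0=-x_2\frac{\partial}{\partial x_2}.$$ Then: (1) $[W_n,W_m]=(n-m)W_{n+m}$ for all $n,m\ge0$. (2) The vector fields of the SABR model are given by $$V_0=\tfrac12\nu^2W_0+\tfrac12(\beta-1)\nu\rho\,W_1+\tfrac12\beta(\beta-1)W_2,\qquad V_1=-\nu\rho\,W_0+(1-\beta)W_1,\qquad V_2=-\nu\sqrt{1-\rho^2}\,W_0.$$ Therefore the SABR model satisfies the Witt condition. (3) The flows of the $W_n$ have the explicit expression $$\exp(tW_n)(x)=\Big(\big(n x_2^n t+(x_1)_+^{n(1-\beta)}\big)_+^{\frac{1}{n(1-\beta)}},\;x_2\Big)\quad(n\ge1),\qquad \exp(tW_0)(x)=(x_1,\;x_2\exp(-t)).$$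
   Context: $B^1,B^2$ are independent Brownian motions and the SDE is in Itô form. For an Itô SDE $dX=b(X)\,dt+\sum_{i=1}^d\sigma_i(X)\,dB^i$, its (Stratonovich) vector fields are $V_i=\sigma_i$ ($1\le i\le d$) and $V_0^k=b^k-\frac12\sum_{i=1}^d\sum_{j}\sigma_i^j\,\partial_j\sigma_i^k$, identified with the first-order differential operators $\sum_kV_i^k\,\partial/\partial x_k$; $[V,V']=VV'-V'V$. $\exp(tW)(x)$ denotes the flow of $tW$ at time one started at $x$, i.e. the value at time $t$ of the solution $u$ of $\dot u=W(u)$, $u(0)=x$. The vector fields and their flows are extended to all of $\mathbf{R}^2$ by means of the positive parts, because flows at negative times are needed in applications; the vector fields and flows are not smooth at critical points such as $(0,x_2)$, and the vector fields are not in $C_b^\infty(\mathbf{R}^2;\mathbf{R}^2)$ (smooth with bounded derivatives of any order). Witt condition: a family $\{V_0,\dots,V_d\}$ satisfies the Witt condition if there is a set of vector fields $\{W_n;n\ge0\}$ with $V_i\in\mathrm{span}\{W_n;n\ge0\}$ for $i=0,\dots,d$ and, for any $n,m\ge0$, $[W_n,W_m]=\alpha_{nm}W_{n+m}$ with $\alpha_{nm}\in\mathbf{R}$.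
   Formalization: For n≥1 the flow formula in (3) is proved as the unique flow when x_1>0 (ODE may fail at finitely many times where W_n is discontinuous); for x_1≤0, where it is no genuine or no unique flow from x, it is shown to be a solution from ((x_1)_+,x_2) and the limit of flows from x_1>0. *)

theory Defs
  imports "HOL-Analysis.Analysis"
begin

type_synonym 'n vfield = "real ^ 'n \<Rightarrow> real ^ 'n"


section \<open>Differential operators on Euclidean space\<close>

definition partial :: "'n::finite \<Rightarrow> (real ^ 'n \<Rightarrow> real) \<Rightarrow> real ^ 'n \<Rightarrow> real" where
  "partial k f x = deriv (\<lambda>h. f (x + h *\<^sub>R axis k 1)) 0"

fun C_on :: "nat \<Rightarrow> (real ^ 'n::finite) set \<Rightarrow> (real ^ 'n \<Rightarrow> real) \<Rightarrow> bool" where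
  "C_on 0 U f \<longleftrightarrow> continuous_on U f"
| "C_on (Suc r) U f \<longleftrightarrow> continuous_on U f \<and>
     (\<forall>k. (\<forall>x\<in>U. (\<lambda>h. f (x + h *\<^sub>R axis k 1)) field_differentiable at 0) \<and>
          C_on r U (partial k f))"

text \<open>Only meant for open \<^term>\<open>U\<close>.\<close>

definition smooth_on :: "(real ^ 'n::finite) set \<Rightarrow> (real ^ 'n \<Rightarrow> real) \<Rightarrow> bool" where
  "smooth_on U f \<longleftrightarrow> (\<forall>r. C_on r U f)"

definition vf_apply :: "'n::finite vfield \<Rightarrow> (real ^ 'n \<Rightarrow> real) \<Rightarrow> real ^ 'n \<Rightarrow> real" where
  "vf_apply V f x = (\<Sum>k\<in>UNIV. V x $ k * partial k f x)"

definition commutator ::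
    "'n::finite vfield \<Rightarrow> 'n vfield \<Rightarrow> (real ^ 'n \<Rightarrow> real) \<Rightarrow> real ^ 'n \<Rightarrow> real" where
  "commutator V V' f x = vf_apply V (vf_apply V' f) x - vf_apply V' (vf_apply V f) x"

text \<open>Equality of the operator \<open>[V, V'] = V V' - V' V\<close> with the vector field \<open>Z\<close>, as
  operators on the smooth functions on the whole space. At a point where a vector field is not
  differentiable but the factor in front of the missing derivative vanishes (as happens on the
  line \<open>x1 = 0\<close> for the fields below) the product counts as 0.\<close>

definition bracket_eq :: "'n::finite vfield \<Rightarrow> 'n vfield \<Rightarrow> 'n vfield \<Rightarrow> bool" where
  "bracket_eq V V' Z \<longleftrightarrow>
     (\<forall>f. smooth_on UNIV f \<longrightarrow> (\<forall>x. commutator V V' f x = vf_apply Z f x))"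

definition in_vf_span :: "'n::finite vfield \<Rightarrow> (nat \<Rightarrow> 'n vfield) \<Rightarrow> bool" where
  "in_vf_span V W \<longleftrightarrow> (\<exists>(N::nat) c::nat \<Rightarrow> real. \<forall>x. V x = (\<Sum>n\<le>N. c n *\<^sub>R W n x))"

text \<open>Vector fields such as those of the SABR model are smooth only off a critical set. The
  \<open>W n\<close> are therefore required to be smooth on a common dense open set \<open>U\<close>, where the brackets
  are the classical ones.\<close>

definition witt_condition :: "nat \<Rightarrow> (nat \<Rightarrow> 'n::finite vfield) \<Rightarrow> bool" where
  "witt_condition d V \<longleftrightarrow>
     (\<exists>(W :: nat \<Rightarrow> 'n vfield) (\<alpha> :: nat \<Rightarrow> nat \<Rightarrow> real).
        (\<exists>U. open U \<and> closure U = UNIV \<and> (\<forall>n k. smooth_on U (\<lambda>x. W n x $ k))) \<and>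
        (\<forall>i\<le>d. in_vf_span (V i) W) \<and>
        (\<forall>n m. bracket_eq (W n) (W m) (\<lambda>x. \<alpha> n m *\<^sub>R W (n + m) x)))"


section \<open>Vector fields of an Ito equation\<close>

text \<open>\<open>\<sigma> i\<close> is the coefficient of the Brownian motion \<open>B i\<close>, for \<open>i = 1, \<dots>, d\<close>.\<close>

definition strat_field ::
    "nat \<Rightarrow> 'n::finite vfield \<Rightarrow> (nat \<Rightarrow> 'n vfield) \<Rightarrow> nat \<Rightarrow> 'n vfield" where
  "strat_field d b \<sigma> i x =
     (if i = 0 then
        (\<chi> k. b x $ k - 1/2 * (\<Sum>i=1..d. \<Sum>j\<in>UNIV. \<sigma> i x $ j * partial j (\<lambda>y. \<sigma> i y $ k) x))
      else \<sigma> i x)"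


section \<open>Flows\<close>

text \<open>A global solution of \<open>u' = W(u)\<close>, \<open>u(0) = x\<close>. The equation has to hold in the classical
  sense at every time at which \<open>W\<close> is continuous at the current position (so this is an ordinary
  classical solution if \<open>W\<close> is continuous), and it may fail only at finitely many times. The
  exception is needed because trajectories of discontinuous fields such as
  \<open>max x1 0 powr (- a)\<close>, \<open>a > 0\<close>, reach the critical line \<open>x1 = 0\<close> in finite time.\<close>

definition ode_solution ::
    "('a::real_normed_vector \<Rightarrow> 'a) \<Rightarrow> 'a \<Rightarrow> (real \<Rightarrow> 'a) \<Rightarrow> bool" where
  "ode_solution W x u \<longleftrightarrow>
     u 0 = x \<and> continuous_on UNIV u \<and>
     (\<forall>s. isCont W (u s) \<longrightarrow> (u has_vector_derivative W (u s)) (at s)) \<and>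
     finite {s. \<not> (u has_vector_derivative W (u s)) (at s)}"

text \<open>\<open>exp_flow W t x\<close> is \<open>exp(tW)(x)\<close>; to be used only where the solution is unique.\<close>

definition exp_flow :: "('a::real_normed_vector \<Rightarrow> 'a) \<Rightarrow> real \<Rightarrow> 'a \<Rightarrow> 'a" where
  "exp_flow W t x = (THE u. ode_solution W x u) t"


section \<open>The SABR model\<close>

definition sabr_drift :: "2 vfield" where
  "sabr_drift x = 0"

definition sabr_sigma :: "real \<Rightarrow> real \<Rightarrow> real \<Rightarrow> nat \<Rightarrow> 2 vfield" where
  "sabr_sigma \<beta> \<nu> \<rho> i x =
     (if i = 1 then vector [x$2 * max (x$1) 0 powr \<beta>, \<nu> * x$2 * \<rho>]
      else if i = 2 then vector [0, \<nu> * x$2 * sqrt (1 - \<rho>\<^sup>2)]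
      else 0)"

definition sabr_field :: "real \<Rightarrow> real \<Rightarrow> real \<Rightarrow> nat \<Rightarrow> 2 vfield" where
  "sabr_field \<beta> \<nu> \<rho> = strat_field 2 sabr_drift (sabr_sigma \<beta> \<nu> \<rho>)"

text \<open>Because of \<open>0 powr a = 0\<close>, \<open>sabr_W \<beta> n\<close> vanishes for \<open>x1 \<le> 0\<close>, \<open>n \<ge> 1\<close>, also if the
  exponent \<open>1 - n (1 - \<beta>)\<close> is zero or negative.\<close>

definition sabr_W :: "real \<Rightarrow> nat \<Rightarrow> 2 vfield" where
  "sabr_W \<beta> n x =
     (if n = 0 then vector [0, - (x$2)]
      else vector [1 / (1 - \<beta>) * max (x$1) 0 powr (1 - real n * (1 - \<beta>)) * x$2 ^ n, 0])"

definition sabr_W_flow :: "real \<Rightarrow> nat \<Rightarrow> real \<Rightarrow> real ^ 2 \<Rightarrow> real ^ 2" where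
  "sabr_W_flow \<beta> n t x =
     (if n = 0 then vector [x$1, x$2 * exp (- t)]
      else vector
        [max (real n * x$2 ^ n * t + max (x$1) 0 powr (real n * (1 - \<beta>))) 0
           powr (1 / (real n * (1 - \<beta>))),
         x$2])"

end

(* The brackets reduce to the commutation of second partial derivatives and one product rule on
   x1 > 0; for x1 <= 0 all terms carry the vanishing coefficient of W n.

   For the flows with n >= 1, x2 is constant along a solution, and as long as v = x1 is positive
   the power v^a with a = n (1 - beta) is affine in time. A solution starting in x1 > 0 stays
   nonnegative because min v 0 has derivative 0 off a finite set. It cannot be positive at a time
   where the affine function of its initial value is <= 0: the positive branch through that time,
   followed back to time 0, would force the two affine functions to coincide. *)

theory Submission
  imports Defs
begin

subsection \<open>Partial derivatives\<close>

text \<open>On x1 > 0 the coordinate y = x1^(1-\<beta>) turns \<open>sabr_W \<beta> n\<close>, n >=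
  1, into the monomial field y^(1-n) x2^n d/dy. This explains the factor 1/(1-\<beta>), the grading
  of the brackets and the fact that y^n is affine along the flow. The obstacle is the line x1 = 0.
  For x2 \<noteq> 0 the exponent 1 - n(1-\<beta>) < 1 makes the field fail to be Lipschitz there,
  and even discontinuous once the exponent is <= 0; moreover constant trajectories compete with
  moving ones. Uniqueness is therefore proved by hand for starting points with x1 > 0, and the
  formula for x1 <= 0 is identified as a limit of those flows. Exceptional times of a solution are
  admissible only where the field is discontinuous, so its continuity and discontinuity points both
  matter.\<close>

lemma vector_2_decompose: "(vector [a, b] :: real ^ 2) = a *\<^sub>R axis 1 1 + b *\<^sub>R axis 2 1"
  by (simp add: vec_eq_iff forall_2 axis_def)

lemma axis_2_nth [simp]:
  "(axis 1 c :: real ^ 2) $ 1 = c" "(axis 1 c :: real ^ 2) $ 2 = 0"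
  "(axis 2 c :: real ^ 2) $ 1 = 0" "(axis 2 c :: real ^ 2) $ 2 = c"
  by (simp_all add: axis_def)

lemma partial_eqI:
  assumes "((\<lambda>h. f (x + h *\<^sub>R axis k 1)) has_real_derivative D) (at 0)"
  shows "partial k f x = D"
  using assms unfolding partial_def by (rule DERIV_imp_deriv)

lemma eventually_line_in_open:
  fixes x :: "real ^ 'n::finite"
  assumes "open U" "x \<in> U"
  shows "eventually (\<lambda>h. x + h *\<^sub>R axis k 1 \<in> U) (nhds (0::real))"
proof -
  have "isCont (\<lambda>h::real. x + h *\<^sub>R axis k 1) 0" by (intro continuous_intros)
  then have "((\<lambda>h::real. x + h *\<^sub>R axis k 1) \<longlongrightarrow> x) (nhds 0)"
    by (simp add: continuous_at tendsto_nhds_iff)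
  then show ?thesis using assms topological_tendstoD by blast
qed

lemma partial_cong_open:
  assumes "open U" "x \<in> U" "\<And>y. y \<in> U \<Longrightarrow> f y = g y"
  shows "partial k f x = partial k g x"
  unfolding partial_def
  by (rule deriv_cong_ev)
    (auto intro: eventually_mono[OF eventually_line_in_open[OF assms(1,2)]] assms(3))

text \<open>Lets a closed formula replace a partial derivative in an induction on the order of
  smoothness. Openness of \<open>U\<close> keeps a short segment around each point inside
  \<open>U\<close>, so that the derivatives agree as well.\<close>

lemma C_on_cong:
  assumes "open U" "\<And>y. y \<in> U \<Longrightarrow> f y = g y" "C_on r U f"
  shows "C_on r U g"
  using assms(2,3)
proof (induction r arbitrary: f g)
  case 0
  then show ?case using continuous_on_cong[of U U f g] by simp
next
  case (Suc r)
  have "(\<lambda>h. g (x + h *\<^sub>R axis k 1)) field_differentiable at 0" if "x \<in> U" for x k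
  proof -
    have ev: "eventually (\<lambda>h. f (x + h *\<^sub>R axis k 1) = g (x + h *\<^sub>R axis k 1)) (nhds 0)"
      by (rule eventually_mono[OF eventually_line_in_open[OF assms(1) that]]) (rule Suc.prems(1))
    have "(\<lambda>h. f (x + h *\<^sub>R axis k 1)) field_differentiable at 0"
      using Suc.prems(2) that by simp
    then obtain D where "((\<lambda>h. f (x + h *\<^sub>R axis k 1)) has_field_derivative D) (at 0)"
      unfolding field_differentiable_def by blast
    then have "((\<lambda>h. g (x + h *\<^sub>R axis k 1)) has_field_derivative D) (at 0)"
      using DERIV_cong_ev[OF refl ev refl] by blast
    then show ?thesis unfolding field_differentiable_def by blast
  qed
  moreover have "C_on r U (partial k g)" for k
    using Suc.IH[of "partial k f" "partial k g"] Suc.prems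
      partial_cong_open[OF assms(1), of _ f g] by simp
  moreover have "continuous_on U g"
    using Suc.prems continuous_on_cong[of U U f g] by simp
  ultimately show ?case by simp
qed

text \<open>\<open>partial\<close> only speaks about the parameter value 0 of a line; shifting the
  base point gives the derivative along the whole line, as the mean value theorem requires.\<close>

lemma C_on_Suc_DERIV:
  assumes "C_on (Suc r) U f" "x + t *\<^sub>R axis k 1 \<in> U"
  shows "((\<lambda>h. f (x + h *\<^sub>R axis k 1)) has_real_derivative partial k f (x + t *\<^sub>R axis k 1)) (at t)"
proof -
  have "(\<lambda>h. f (x + t *\<^sub>R axis k 1 + h *\<^sub>R axis k 1)) field_differentiable at 0"
    using assms by simp
  then have "((\<lambda>h. f (x + (h + t) *\<^sub>R axis k 1)) has_real_derivative partial k f (x + t *\<^sub>R axis k 1)) (at 0)"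
    unfolding partial_def by (simp add: field_differentiable_derivI algebra_simps)
  then show ?thesis
    using DERIV_shift[of "\<lambda>h. f (x + h *\<^sub>R axis k 1)" _ 0 t] by simp
qed

text \<open>Two applications of the mean value theorem: first in direction \<open>i\<close> to a
  difference taken in direction \<open>j\<close>, then in direction \<open>j\<close> to
  \<open>partial i f\<close>. The left-hand side is symmetric in \<open>i\<close> and
  \<open>j\<close>, the right-hand side fixes an order of differentiation.\<close>

lemma mixed_difference_quotient:
  fixes f :: "real ^ 'n::finite \<Rightarrow> real"
  assumes f: "C_on 2 UNIV f" and h: "0 < h"
  obtains s t where "0 < s" "s < h" "0 < t" "t < h"
    "f (x + h *\<^sub>R axis i 1 + h *\<^sub>R axis j 1) - f (x + h *\<^sub>R axis i 1) - f (x + h *\<^sub>R axis j 1) + f x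
      = h\<^sup>2 * partial j (partial i f) (x + s *\<^sub>R axis i 1 + t *\<^sub>R axis j 1)"
proof -
  have f1: "C_on (Suc 1) UNIV f" using f by (simp add: numeral_2_eq_2)
  then have f2: "C_on (Suc 0) UNIV (partial i f)" by simp
  define \<phi> where "\<phi> s = f (x + h *\<^sub>R axis j 1 + s *\<^sub>R axis i 1) - f (x + s *\<^sub>R axis i 1)" for s
  have "DERIV \<phi> s :> partial i f (x + h *\<^sub>R axis j 1 + s *\<^sub>R axis i 1) - partial i f (x + s *\<^sub>R axis i 1)" for s
    unfolding \<phi>_def by (intro DERIV_diff C_on_Suc_DERIV[OF f1]) auto
  from MVT2[OF h this] obtain s where s: "0 < s" "s < h" and
    \<phi>: "\<phi> h - \<phi> 0 = h * (partial i f (x + h *\<^sub>R axis j 1 + s *\<^sub>R axis i 1) - partial i f (x + s *\<^sub>R axis i 1))"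
    by auto
  have "DERIV (\<lambda>t. partial i f (x + s *\<^sub>R axis i 1 + t *\<^sub>R axis j 1)) t :>
      partial j (partial i f) (x + s *\<^sub>R axis i 1 + t *\<^sub>R axis j 1)" for t
    by (intro C_on_Suc_DERIV[OF f2]) auto
  from MVT2[OF h this] obtain t where t: "0 < t" "t < h" and
    \<psi>: "partial i f (x + s *\<^sub>R axis i 1 + h *\<^sub>R axis j 1) - partial i f (x + s *\<^sub>R axis i 1)
      = h * partial j (partial i f) (x + s *\<^sub>R axis i 1 + t *\<^sub>R axis j 1)"
    by auto
  show ?thesis
    using that[OF s t] \<phi> \<psi> unfolding \<phi>_def by (simp add: power2_eq_square ac_simps)
qed

text \<open>Schwarz's theorem: by continuity the symmetric second difference quotient tends to
  either mixed derivative, so the two limits coincide.\<close>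

lemma partial_commute:
  fixes f :: "real ^ 'n::finite \<Rightarrow> real"
  assumes f: "C_on 2 UNIV f"
  shows "partial i (partial j f) x = partial j (partial i f) x"
proof -
  define \<Delta> where "\<Delta> i j h = (f (x + h *\<^sub>R axis i 1 + h *\<^sub>R axis j 1) - f (x + h *\<^sub>R axis i 1)
      - f (x + h *\<^sub>R axis j 1) + f x) / h\<^sup>2" for i j h
  have lim: "(\<Delta> i j \<longlongrightarrow> partial j (partial i f) x) (at_right 0)" for i j
  proof -
    \<comment> \<open>The condition \<open>0 < h\<close> sits inside the existential, so that
      intermediate points can be chosen as total functions of \<open>h\<close>.\<close>
    have "\<exists>s t. 0 < h \<longrightarrow> 0 < s \<and> s < h \<and> 0 < t \<and> t < h \<and>
        \<Delta> i j h = partial j (partial i f) (x + s *\<^sub>R axis i 1 + t *\<^sub>R axis j 1)" for h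
    proof (cases "0 < h")
      case True
      from mixed_difference_quotient[OF f this, of x i j] show ?thesis
        by (metis True \<Delta>_def nonzero_mult_div_cancel_left less_numeral_extra(3) zero_less_power)
    qed auto
    then obtain s t where st: "\<And>h. 0 < h \<Longrightarrow> 0 < s h \<and> s h < h \<and> 0 < t h \<and> t h < h \<and>
        \<Delta> i j h = partial j (partial i f) (x + s h *\<^sub>R axis i 1 + t h *\<^sub>R axis j 1)"
      by metis
    have pos: "eventually (\<lambda>h::real. 0 < h) (at_right 0)"
      by (simp add: eventually_at_right_less)
    have s0: "(s \<longlongrightarrow> 0) (at_right 0)"
      by (rule tendsto_sandwich[of "\<lambda>_. 0" _ _ "\<lambda>h. h"])
        (use st in \<open>auto intro!: eventually_mono[OF pos] less_imp_le tendsto_ident_at\<close>)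
    have t0: "(t \<longlongrightarrow> 0) (at_right 0)"
      by (rule tendsto_sandwich[of "\<lambda>_. 0" _ _ "\<lambda>h. h"])
        (use st in \<open>auto intro!: eventually_mono[OF pos] less_imp_le tendsto_ident_at\<close>)
    have "((\<lambda>h. x + s h *\<^sub>R axis i 1 + t h *\<^sub>R axis j 1) \<longlongrightarrow> x + 0 *\<^sub>R axis i 1 + 0 *\<^sub>R axis j 1) (at_right 0)"
      by (intro tendsto_intros s0 t0)
    then have path: "((\<lambda>h. x + s h *\<^sub>R axis i 1 + t h *\<^sub>R axis j 1) \<longlongrightarrow> x) (at_right 0)"
      by simp
    have "isCont (partial j (partial i f)) x"
      using f by (simp add: numeral_2_eq_2 continuous_on_eq_continuous_at)
    from isCont_tendsto_compose[OF this path]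
    have "((\<lambda>h. partial j (partial i f) (x + s h *\<^sub>R axis i 1 + t h *\<^sub>R axis j 1))
        \<longlongrightarrow> partial j (partial i f) x) (at_right 0)" .
    then show ?thesis
      by (rule Lim_transform_eventually) (rule eventually_mono[OF pos], simp add: st)
  qed
  have "\<Delta> i j = \<Delta> j i" by (auto simp: \<Delta>_def fun_eq_iff ac_simps)
  with lim[of i j] lim[of j i] show ?thesis
    using tendsto_unique[OF trivial_limit_at_right_real] by metis
qed

subsection \<open>Powers of the positive part\<close>

text \<open>Away from 0 the function is locally a power or 0. At 0 the difference quotient is itself
  the power with exponent a - 1, which tends to 0 exactly because a > 1.\<close>

lemma DERIV_max_powr:
  fixes x a :: real
  assumes "x \<noteq> 0 \<or> 1 < a"
  shows "((\<lambda>s. max s 0 powr a) has_real_derivative a * max x 0 powr (a - 1)) (at x)"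
proof (cases x "0::real" rule: linorder_cases)
  case greater
  have "((\<lambda>s. s powr a) has_real_derivative a * x powr (a - 1)) (at x)"
    using greater by (rule has_real_derivative_powr)
  moreover have "eventually (\<lambda>s. max s 0 powr a = s powr a) (nhds x)"
    using greater by (intro eventually_mono[OF eventually_nhds_in_open[of "{0<..}" x]]) auto
  ultimately show ?thesis
    using greater DERIV_cong_ev[OF refl _ refl, of "\<lambda>s. max s 0 powr a" "\<lambda>s. s powr a" x] by simp
next
  case less
  have "eventually (\<lambda>s. max s 0 powr a = 0) (nhds x)"
    using less by (intro eventually_mono[OF eventually_nhds_in_open[of "{..<0}" x]]) auto
  then show ?thesis
    using less DERIV_cong_ev[OF refl _ refl, of "\<lambda>s. max s 0 powr a" "\<lambda>s. 0" x] by simp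
next
  case equal
  with assms have a: "1 < a" by simp
  have "((\<lambda>h. max h 0 powr (a - 1)) \<longlongrightarrow> max 0 0 powr (a - 1)) (at (0::real))"
    using a by (intro tendsto_powr' tendsto_max tendsto_intros) auto
  then have "((\<lambda>h. max h 0 powr (a - 1)) \<longlongrightarrow> 0) (at (0::real))" by simp
  \<comment> \<open>For h <= 0, including h = 0, both sides are 0 since \<open>0 powr a = 0\<close>
    and 0 divided by anything is 0.\<close>
  moreover have "max h 0 powr (a - 1) = (max (0 + h) 0 powr a - max 0 0 powr a) / h" for h :: real
    by (cases "h > 0") (auto simp: powr_diff max_def)
  ultimately show ?thesis
    unfolding equal DERIV_def by simp
qed

text \<open>The class is closed under both partial derivatives, so one induction over all parameters
  suffices. The summand \<open>d\<close> supplies monomials in x2 alone, such as the component of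
  \<open>sabr_W \<beta> 0\<close>: the choice a = 0 would not, because
  \<open>max (x$1) 0 powr 0\<close> is 0 for x1 < 0.\<close>

lemma smooth_on_max_powr_monomial:
  fixes c d a :: real
  shows "smooth_on {x :: real ^ 2. x$1 \<noteq> 0} (\<lambda>x. (c * max (x$1) 0 powr a + d) * x$2 ^ m)"
  unfolding smooth_on_def
proof (rule allI)
  let ?U = "{x :: real ^ 2. x$1 \<noteq> 0}"
  fix r show "C_on r ?U (\<lambda>x. (c * max (x$1) 0 powr a + d) * x$2 ^ m)"
  proof (induction r arbitrary: c d a m)
    case 0
    have "isCont (\<lambda>s. max s 0 powr a) s" if "s \<noteq> 0" for s :: real
      using DERIV_isCont[OF DERIV_max_powr] that by blast
    then have "continuous_on (- {0}) (\<lambda>s::real. max s 0 powr a)"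
      by (auto intro: continuous_at_imp_continuous_on)
    then have "continuous_on ?U (\<lambda>x. max (x$1) 0 powr a)"
      by (rule continuous_on_compose2) (auto intro!: continuous_intros)
    then show ?case by (auto intro!: continuous_intros)
  next
    case (Suc r)
    let ?f = "\<lambda>x::real^2. (c * max (x$1) 0 powr a + d) * x$2 ^ m"
    let ?p1 = "\<lambda>x::real^2. (c * a * max (x$1) 0 powr (a - 1) + 0) * x$2 ^ m"
    \<comment> \<open>For m = 0 the truncated exponent \<open>m - 1\<close> is harmless, since both
      coefficients contain \<open>real m\<close>.\<close>
    let ?p2 = "\<lambda>x::real^2. (c * real m * max (x$1) 0 powr a + d * real m) * x$2 ^ (m - 1)"
    have U: "open ?U" by (intro open_Collect_neq continuous_intros)
    have d1: "((\<lambda>h. ?f (x + h *\<^sub>R axis 1 1)) has_real_derivative ?p1 x) (at 0)"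
      if "x \<in> ?U" for x
    proof -
      have "((\<lambda>h. max (h + x$1) 0 powr a) has_real_derivative a * max (x$1) 0 powr (a - 1)) (at 0)"
        using DERIV_shift[of "\<lambda>s. max s 0 powr a" _ 0 "x$1"] DERIV_max_powr[of "x$1" a] that by simp
      then have "((\<lambda>h. (c * max (h + x$1) 0 powr a + d) * x$2 ^ m) has_real_derivative
          (c * (a * max (x$1) 0 powr (a - 1)) + 0) * x$2 ^ m) (at 0)"
        by (intro DERIV_cmult_right DERIV_add DERIV_cmult DERIV_const)
      then show ?thesis by (simp add: ac_simps)
    qed
    have d2: "((\<lambda>h. ?f (x + h *\<^sub>R axis 2 1)) has_real_derivative ?p2 x) (at 0)" for x
    proof -
      have "((\<lambda>h. (x$2 + h) ^ m) has_real_derivative real m * (x$2 + 0) ^ (m - 1)) (at 0)"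
        by (auto intro!: derivative_eq_intros)
      from DERIV_cmult[OF this, of "c * max (x$1) 0 powr a + d"]
      have "((\<lambda>h. ?f (x + h *\<^sub>R axis 2 1)) has_real_derivative
          (c * max (x$1) 0 powr a + d) * (real m * x$2 ^ (m - 1))) (at 0)"
        by simp
      also have "(c * max (x$1) 0 powr a + d) * (real m * x$2 ^ (m - 1)) = ?p2 x"
        by (simp add: algebra_simps)
      finally show ?thesis .
    qed
    have p1: "C_on r ?U (partial 1 ?f)"
      by (rule C_on_cong[OF U _ Suc.IH[of "c * a" "a - 1" 0 m]]) (rule partial_eqI[OF d1, symmetric])
    have p2: "C_on r ?U (partial 2 ?f)"
      by (rule C_on_cong[OF U _ Suc.IH[of "c * real m" a "d * real m" "m - 1"]])
        (rule partial_eqI[OF d2, symmetric])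
    have cont: "continuous_on ?U ?f"
      using Suc.IH[of c a d m] C_on.simps by (cases r) blast+
    have "(\<lambda>h. ?f (x + h *\<^sub>R axis 1 1)) field_differentiable at 0" if "x \<in> ?U" for x
      using d1[OF that] field_differentiable_def by fast
    moreover have "(\<lambda>h. ?f (x + h *\<^sub>R axis 2 1)) field_differentiable at 0" for x
      using d2[of x] field_differentiable_def by fast
    ultimately show ?case
      unfolding C_on.simps(2) forall_2 using p1 p2 cont by (intro conjI ballI)
  qed
qed

subsection \<open>Brackets and coefficients\<close>

lemma vf_apply_2: "vf_apply V f x = V x $ 1 * partial 1 f x + V x $ 2 * partial 2 f x"
  for V :: "2 vfield"
  by (simp add: vf_apply_def sum_2)

lemma sabr_W_0_nth [simp]: "sabr_W \<beta> 0 x $ 1 = 0" "sabr_W \<beta> 0 x $ 2 = - (x$2)"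
  by (simp_all add: sabr_W_def)

lemma sabr_W_nth:
  assumes "n \<ge> 1"
  shows "sabr_W \<beta> n x $ 1 = 1 / (1 - \<beta>) * max (x$1) 0 powr (1 - real n * (1 - \<beta>)) * x$2 ^ n"
    and "sabr_W \<beta> n x $ 2 = 0"
  using assms by (simp_all add: sabr_W_def)

lemma commutator_swap: "commutator V V' f x = - commutator V' V f x"
  by (simp add: commutator_def)

lemma max_powr_line_DERIV:
  fixes x :: "real ^ 2"
  assumes "x$1 \<noteq> 0 \<or> 1 < a"
  shows "((\<lambda>h. max ((x + h *\<^sub>R axis 1 1)$1) 0 powr a) has_real_derivative
    a * max (x$1) 0 powr (a - 1)) (at 0)"
  using DERIV_shift[of "\<lambda>s. max s 0 powr a" _ 0 "x$1"] DERIV_max_powr[of "x$1" a] assms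
  by (simp add: add.commute)

lemma smooth_on_partial_DERIV:
  assumes "smooth_on UNIV f"
  shows "((\<lambda>h. f (x + h *\<^sub>R axis k 1)) has_real_derivative partial k f x) (at 0)"
    and "((\<lambda>h. partial j f (x + h *\<^sub>R axis k 1)) has_real_derivative partial k (partial j f) x) (at 0)"
proof -
  have 1: "C_on (Suc (Suc 0)) UNIV f" using assms unfolding smooth_on_def by blast
  then have 2: "C_on (Suc 0) UNIV (partial j f)" by simp
  show "((\<lambda>h. f (x + h *\<^sub>R axis k 1)) has_real_derivative partial k f x) (at 0)"
    using C_on_Suc_DERIV[OF 1, of x 0 k] by simp
  show "((\<lambda>h. partial j f (x + h *\<^sub>R axis k 1)) has_real_derivative partial k (partial j f) x) (at 0)"
    using C_on_Suc_DERIV[OF 2, of x 0 k] by simp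
qed

lemma partial_eq_0_on_slice:
  assumes "\<And>h. f (x + h *\<^sub>R axis k 1) = 0"
  shows "partial k f x = 0"
  unfolding partial_def assms by simp

text \<open>Both fields are multiples of d/dx1, so the terms with the second derivative of
  \<open>f\<close> are equal and cancel. What remains carries the difference of the two exponents,
  (1-\<beta>)(n - m), whose factor 1-\<beta> removes one of the two prefactors
  1/(1-\<beta>).\<close>

lemma commutator_sabr_W_pos_pos:
  assumes "\<beta> < 1" and f: "smooth_on UNIV f" and "n \<ge> 1" "m \<ge> 1"
  shows "commutator (sabr_W \<beta> n) (sabr_W \<beta> m) f x
    = vf_apply (\<lambda>x. (real n - real m) *\<^sub>R sabr_W \<beta> (n + m) x) f x"
proof (cases "x$1 > 0")
  case True
  define a where "a n = 1 - real n * (1 - \<beta>)" for n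
  have p: "partial 1 (vf_apply (sabr_W \<beta> n) f) x
      = 1 / (1 - \<beta>) * (a n * x$1 powr (a n - 1)) * x$2 ^ n * partial 1 f x
        + 1 / (1 - \<beta>) * x$1 powr a n * x$2 ^ n * partial 1 (partial 1 f) x"
    if n: "n \<ge> 1" for n
  proof (rule partial_eqI)
    have "((\<lambda>h. 1 / (1 - \<beta>) * max ((x + h *\<^sub>R axis 1 1)$1) 0 powr a n * x$2 ^ n)
        has_real_derivative 1 / (1 - \<beta>) * (a n * max (x$1) 0 powr (a n - 1)) * x$2 ^ n) (at 0)"
      by (intro DERIV_cmult_right DERIV_cmult max_powr_line_DERIV) (use True in simp)
    from DERIV_mult[OF this smooth_on_partial_DERIV(2)[OF f, of 1 x 1]]
    show "((\<lambda>h. vf_apply (sabr_W \<beta> n) f (x + h *\<^sub>R axis 1 1)) has_real_derivative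
      1 / (1 - \<beta>) * (a n * x$1 powr (a n - 1)) * x$2 ^ n * partial 1 f x
        + 1 / (1 - \<beta>) * x$1 powr a n * x$2 ^ n * partial 1 (partial 1 f) x) (at 0)"
      using True by (simp add: vf_apply_2 sabr_W_nth[OF n] a_def ac_simps)
  qed
  \<comment> \<open>The grading comes from here: a n + a m - 1 = a (n + m).\<close>
  have e: "x$1 powr a n * x$1 powr (a m - 1) = x$1 powr a (n + m)" for n m
    by (simp add: a_def powr_add[symmetric] algebra_simps)
  have W: "vf_apply (sabr_W \<beta> n) g x = 1 / (1 - \<beta>) * x$1 powr a n * x$2 ^ n * partial 1 g x"
    if "n \<ge> 1" for n g
    using True by (simp add: vf_apply_2 sabr_W_nth[OF that] a_def)
  define y z F F2 g where "y = x$1" and "z = x$2" and "F = partial 1 f x"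
    and "F2 = partial 1 (partial 1 f) x" and "g = 1 / (1 - \<beta>)"
  have e': "y powr a m * y powr (a n - 1) = y powr a (n + m)"
    "y powr a n * y powr (a m - 1) = y powr a (n + m)"
    using e[of n m] e[of m n] by (simp_all add: y_def add.commute)
  have "commutator (sabr_W \<beta> n) (sabr_W \<beta> m) f x =
      g * y powr a n * z ^ n * (g * (a m * y powr (a m - 1)) * z ^ m * F + g * y powr a m * z ^ m * F2)
      - g * y powr a m * z ^ m * (g * (a n * y powr (a n - 1)) * z ^ n * F + g * y powr a n * z ^ n * F2)"
    unfolding commutator_def W[OF assms(3)] W[OF assms(4)] p[OF assms(3)] p[OF assms(4)]
      y_def z_def F_def F2_def g_def ..
  also have "\<dots> = g * g * z ^ n * z ^ m * F *
      (a m * (y powr a n * y powr (a m - 1)) - a n * (y powr a m * y powr (a n - 1)))"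
    by (simp add: algebra_simps)
  also have "\<dots> = g * (g * (a m - a n)) * z ^ (n + m) * F * y powr a (n + m)"
    unfolding e' by (simp add: algebra_simps power_add)
  also have "a m - a n = (1 - \<beta>) * (real n - real m)" by (simp add: a_def algebra_simps)
  also have "g * ((1 - \<beta>) * (real n - real m)) = real n - real m"
    using assms(1) by (simp add: g_def)
  also have "g * (real n - real m) * z ^ (n + m) * F * y powr a (n + m)
      = vf_apply (\<lambda>x. (real n - real m) *\<^sub>R sabr_W \<beta> (n + m) x) f x"
    using True assms(3) by (simp add: vf_apply_2 sabr_W_nth a_def g_def y_def z_def F_def)
  finally show ?thesis .
next
  case False
  with assms show ?thesis
    by (simp add: commutator_def vf_apply_2 sabr_W_nth)
qed

text \<open>The coefficient of \<open>sabr_W \<beta> n\<close> is differentiated only in x2, where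
  it is a monomial, and that of \<open>sabr_W \<beta> 0\<close> does not depend on x1. Hence the
  computation is valid at every point, the critical line included.\<close>

lemma commutator_sabr_W_0_pos:
  assumes f: "smooth_on UNIV f" and n: "n \<ge> 1"
  shows "commutator (sabr_W \<beta> 0) (sabr_W \<beta> n) f x
    = vf_apply (\<lambda>x. (0 - real n) *\<^sub>R sabr_W \<beta> n x) f x"
proof -
  define A where "A = 1 / (1 - \<beta>) * max (x$1) 0 powr (1 - real n * (1 - \<beta>))"
  have p2: "partial 2 (vf_apply (sabr_W \<beta> n) f) x
      = A * (real n * x$2 ^ (n - 1)) * partial 1 f x + A * x$2 ^ n * partial 1 (partial 2 f) x"
  proof (rule partial_eqI)
    have "((\<lambda>h. (x$2 + h) ^ n) has_real_derivative real n * (x$2 + 0) ^ (n - 1)) (at 0)"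
      by (auto intro!: derivative_eq_intros)
    then have "((\<lambda>h. A * (x + h *\<^sub>R axis 2 1)$2 ^ n) has_real_derivative A * (real n * x$2 ^ (n - 1))) (at 0)"
      by (intro DERIV_cmult) simp
    from DERIV_mult[OF this smooth_on_partial_DERIV(2)[OF f, of 1 x 2]]
    have "((\<lambda>h. A * (x + h *\<^sub>R axis 2 1)$2 ^ n * partial 1 f (x + h *\<^sub>R axis 2 1)) has_real_derivative
        A * (real n * x$2 ^ (n - 1)) * partial 1 f x + partial 2 (partial 1 f) x * (A * x$2 ^ n)) (at 0)"
      by simp
    \<comment> \<open>Symmetry of the second derivatives makes the second order terms of the two
      products cancel.\<close>
    moreover have "partial 2 (partial 1 f) x = partial 1 (partial 2 f) x"
      using f partial_commute unfolding smooth_on_def by blast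
    moreover have "vf_apply (sabr_W \<beta> n) f (x + h *\<^sub>R axis 2 1)
        = A * (x + h *\<^sub>R axis 2 1)$2 ^ n * partial 1 f (x + h *\<^sub>R axis 2 1)" for h
      by (simp add: vf_apply_2 sabr_W_nth[OF n] A_def)
    ultimately show "((\<lambda>h. vf_apply (sabr_W \<beta> n) f (x + h *\<^sub>R axis 2 1)) has_real_derivative
        A * (real n * x$2 ^ (n - 1)) * partial 1 f x + A * x$2 ^ n * partial 1 (partial 2 f) x) (at 0)"
      by (simp add: mult.commute)
  qed
  have p1: "partial 1 (vf_apply (sabr_W \<beta> 0) f) x = - x$2 * partial 1 (partial 2 f) x"
  proof (rule partial_eqI)
    show "((\<lambda>h. vf_apply (sabr_W \<beta> 0) f (x + h *\<^sub>R axis 1 1)) has_real_derivative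
        - x$2 * partial 1 (partial 2 f) x) (at 0)"
      using DERIV_cmult[OF smooth_on_partial_DERIV(2)[OF f, of 2 x 1], of "- x$2"]
      by (simp add: vf_apply_2)
  qed
  have W: "sabr_W \<beta> n x $ 1 = A * x$2 ^ n" "sabr_W \<beta> n x $ 2 = 0"
    by (simp_all add: sabr_W_nth[OF n] A_def)
  obtain k where "n = Suc k" using n by (cases n) auto
  then have "A * (real n * x$2 ^ (n - 1)) * x$2 = real n * (A * x$2 ^ n)"
    by simp
  moreover have "commutator (sabr_W \<beta> 0) (sabr_W \<beta> n) f x
      = - (A * (real n * x$2 ^ (n - 1)) * x$2) * partial 1 f x"
    unfolding commutator_def vf_apply_2[of "sabr_W \<beta> 0" "vf_apply (sabr_W \<beta> n) f"]
      vf_apply_2[of "sabr_W \<beta> n" "vf_apply (sabr_W \<beta> 0) f"] p1 p2 W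
    by (simp add: algebra_simps)
  ultimately show ?thesis
    by (simp add: vf_apply_2 W)
qed

lemma bracket_sabr_W:
  assumes "\<beta> < 1"
  shows "bracket_eq (sabr_W \<beta> n) (sabr_W \<beta> m) (\<lambda>x. (real n - real m) *\<^sub>R sabr_W \<beta> (n + m) x)"
  unfolding bracket_eq_def
proof (intro allI impI)
  fix f x assume f: "smooth_on UNIV (f :: real ^ 2 \<Rightarrow> real)"
  consider "n = 0" "m = 0" | "n = 0" "m \<ge> 1" | "n \<ge> 1" "m = 0" | "n \<ge> 1" "m \<ge> 1"
    by linarith
  then show "commutator (sabr_W \<beta> n) (sabr_W \<beta> m) f x =
      vf_apply (\<lambda>x. (real n - real m) *\<^sub>R sabr_W \<beta> (n + m) x) f x"
  proof cases
    case 1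
    then show ?thesis by (simp add: commutator_def vf_apply_2)
  next
    case 2
    then show ?thesis using commutator_sabr_W_0_pos[OF f, of m \<beta> x] by simp
  next
    case 3
    have "commutator (sabr_W \<beta> n) (sabr_W \<beta> 0) f x = - vf_apply (\<lambda>x. (0 - real n) *\<^sub>R sabr_W \<beta> n x) f x"
      using commutator_swap commutator_sabr_W_0_pos[OF f 3(1)] by metis
    with 3 show ?thesis by (simp add: vf_apply_2)
  next
    case 4
    then show ?thesis using commutator_sabr_W_pos_pos[OF assms f] by blast
  qed
qed

section \<open>Stratonovich fields of the SABR model\<close>

lemma sabr_sigma_nth [simp]:
  "sabr_sigma \<beta> \<nu> \<rho> 1 x $ 1 = x$2 * max (x$1) 0 powr \<beta>"
  "sabr_sigma \<beta> \<nu> \<rho> 1 x $ 2 = \<nu> * x$2 * \<rho>"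
  "sabr_sigma \<beta> \<nu> \<rho> (Suc 0) x $ 1 = x$2 * max (x$1) 0 powr \<beta>"
  "sabr_sigma \<beta> \<nu> \<rho> (Suc 0) x $ 2 = \<nu> * x$2 * \<rho>"
  "sabr_sigma \<beta> \<nu> \<rho> 2 x $ 1 = 0"
  "sabr_sigma \<beta> \<nu> \<rho> 2 x $ 2 = \<nu> * x$2 * sqrt (1 - \<rho>\<^sup>2)"
  by (simp_all add: sabr_sigma_def)

text \<open>The Ito correction produces the powers \<beta> = 1 - (1-\<beta>) and 2\<beta> - 1 = 1 -
  2(1-\<beta>) of x1, which are those of \<open>sabr_W \<beta> 1\<close> and
  \<open>sabr_W \<beta> 2\<close>.\<close>

lemma sabr_field_0_eq:
  assumes beta: "\<beta> < 1" and rho: "\<bar>\<rho>\<bar> \<le> 1"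
  shows "sabr_field \<beta> \<nu> \<rho> 0 x =
              (1/2 * \<nu>\<^sup>2) *\<^sub>R sabr_W \<beta> 0 x
              + (1/2 * (\<beta> - 1) * \<nu> * \<rho>) *\<^sub>R sabr_W \<beta> 1 x
              + (1/2 * \<beta> * (\<beta> - 1)) *\<^sub>R sabr_W \<beta> 2 x"
proof -
  \<comment> \<open>This merges the contributions of the two Brownian motions to the second
    component into \<nu>^2, independently of \<rho>.\<close>
  have r: "sqrt (1 - \<rho>\<^sup>2) * sqrt (1 - \<rho>\<^sup>2) = 1 - \<rho>\<^sup>2"
    using rho by (simp add: abs_square_le_1)
  \<comment> \<open>The factor stays in front of the derivative: for x1 <= 0 it is 0, so the value
    of \<open>partial\<close> at the nondifferentiable line is irrelevant.\<close>
  have p1: "max (x$1) 0 powr \<beta> * partial 1 (\<lambda>y. y$2 * max (y$1) 0 powr \<beta>) x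
      = x$2 * (\<beta> * max (x$1) 0 powr (2 * \<beta> - 1))"
  proof (cases "x$1 > 0")
    case True
    have "((\<lambda>h. x$2 * max ((x + h *\<^sub>R axis 1 1)$1) 0 powr \<beta>) has_real_derivative
        x$2 * (\<beta> * max (x$1) 0 powr (\<beta> - 1))) (at 0)"
      by (intro DERIV_cmult max_powr_line_DERIV) (use True in simp)
    then have "partial 1 (\<lambda>y. y$2 * max (y$1) 0 powr \<beta>) x = x$2 * (\<beta> * x$1 powr (\<beta> - 1))"
      by (intro partial_eqI) (use True in simp)
    moreover have "x$1 powr \<beta> * x$1 powr (\<beta> - 1) = x$1 powr (2 * \<beta> - 1)"
      by (simp add: powr_add[symmetric])
    ultimately show ?thesis using True by simp
  qed simp
  have p2: "partial 2 (\<lambda>y. y$2 * max (y$1) 0 powr \<beta>) x = max (x$1) 0 powr \<beta>"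
    by (rule partial_eqI) (auto intro!: derivative_eq_intros)
  have q1: "partial 1 (\<lambda>y::real^2. \<nu> * y$2 * c) x = 0" for c
    by (rule partial_eqI) (auto intro!: derivative_eq_intros)
  have q2: "partial 2 (\<lambda>y::real^2. \<nu> * y$2 * c) x = \<nu> * c" for c
    by (rule partial_eqI) (auto intro!: derivative_eq_intros)
  have z: "partial k (\<lambda>y::real^2. 0) x = 0" for k
    by (rule partial_eq_0_on_slice) simp
  have ind: "{Suc 0..2} = {1, 2}" by auto
  have "sabr_field \<beta> \<nu> \<rho> 0 x $ 1 = - 1/2 * (x$2 * (max (x$1) 0 powr \<beta>
        * partial 1 (\<lambda>y. y$2 * max (y$1) 0 powr \<beta>) x) + \<nu> * x$2 * \<rho> * max (x$1) 0 powr \<beta>)"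
    unfolding sabr_field_def strat_field_def
    by (simp add: sabr_drift_def sum_2 p2 z ind)
  moreover have "sabr_field \<beta> \<nu> \<rho> 0 x $ 2 = - 1/2 * (\<nu> * x$2 * \<rho> * (\<nu> * \<rho>)
      + \<nu> * x$2 * (\<nu> * (sqrt (1 - \<rho>\<^sup>2) * sqrt (1 - \<rho>\<^sup>2))))"
    unfolding sabr_field_def strat_field_def
    by (simp add: sabr_drift_def sum_2 q1 q2 ind)
  moreover have "(1/2 * (\<beta> - 1) * \<nu> * \<rho>) * (1 / (1 - \<beta>) * M * x$2)
      + (1/2 * \<beta> * (\<beta> - 1)) * (1 / (1 - \<beta>) * N * (x$2)\<^sup>2)
      = - 1/2 * (x$2 * (x$2 * (\<beta> * N)) + \<nu> * x$2 * \<rho> * M)" for M N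
  proof -
    have c: "(\<beta> - 1) * (1 / (1 - \<beta>)) = - 1" using beta by (simp add: field_simps)
    have e: "(1/2 * (\<beta> - 1) * \<nu> * \<rho>) * (1 / (1 - \<beta>) * M * x$2)
      + (1/2 * \<beta> * (\<beta> - 1)) * (1 / (1 - \<beta>) * N * (x$2)\<^sup>2)
      = ((\<beta> - 1) * (1 / (1 - \<beta>))) * (1/2 * (x$2 * (x$2 * (\<beta> * N)) + \<nu> * x$2 * \<rho> * M))"
      by (simp add: algebra_simps power2_eq_square add_divide_distrib diff_divide_distrib)
    show ?thesis unfolding e c by linarith
  qed
  note this[of "max (x$1) 0 powr \<beta>" "max (x$1) 0 powr (2 * \<beta> - 1)"]
  ultimately show ?thesis
    unfolding p1 r vec_eq_iff forall_2
    by (simp add: sabr_W_nth algebra_simps power2_eq_square)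
qed

lemma sabr_field_1_eq:
  "\<beta> < 1 \<Longrightarrow> sabr_field \<beta> \<nu> \<rho> 1 x = (- \<nu> * \<rho>) *\<^sub>R sabr_W \<beta> 0 x + (1 - \<beta>) *\<^sub>R sabr_W \<beta> 1 x"
  by (simp add: sabr_field_def strat_field_def vec_eq_iff forall_2 sabr_W_nth)

lemma sabr_field_2_eq: "sabr_field \<beta> \<nu> \<rho> 2 x = (- \<nu> * sqrt (1 - \<rho>\<^sup>2)) *\<^sub>R sabr_W \<beta> 0 x"
  by (simp add: sabr_field_def strat_field_def vec_eq_iff forall_2)

section \<open>Witt condition off the critical line\<close>

lemma closure_off_axis: "closure {x :: real ^ 2. x$1 \<noteq> 0} = UNIV"
proof -
  have "{x :: real ^ 2. x$1 \<noteq> 0} = - {x. axis 1 1 \<bullet> x = 0}"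
    by (auto simp: inner_axis' )
  then show ?thesis
    by (simp add: closure_complement interior_hyperplane)
qed

lemma witt_condition_sabr:
  assumes beta: "\<beta> < 1" and rho: "\<bar>\<rho>\<bar> \<le> 1"
  shows "witt_condition 2 (sabr_field \<beta> \<nu> \<rho>)"
  unfolding witt_condition_def
\<comment> \<open>The witnesses stay schematic and are fixed by the facts shown below: the dense
  open set \<open>?U\<close>, the family \<open>sabr_W \<beta>\<close> and the structure constants
  \<open>real n - real m\<close>.\<close>
proof (intro exI conjI allI impI)
  let ?U = "{x :: real ^ 2. x$1 \<noteq> 0}"
  show "open ?U" by (intro open_Collect_neq continuous_intros)
  show "closure ?U = UNIV" by (rule closure_off_axis)
  show "smooth_on ?U (\<lambda>x. sabr_W \<beta> n x $ k)" for n k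
  proof (cases "n \<ge> 1")
    case True
    show ?thesis
      using exhaust_2[of k] smooth_on_max_powr_monomial[of "1 / (1 - \<beta>)" "1 - real n * (1 - \<beta>)" 0 n]
        smooth_on_max_powr_monomial[of 0 0 0 0]
      by (auto simp: sabr_W_nth[OF True])
  next
    case False
    then have "n = 0" by simp
    then show ?thesis
      using exhaust_2[of k] smooth_on_max_powr_monomial[of 0 0 "-1" 1]
        smooth_on_max_powr_monomial[of 0 0 0 0] by auto
  qed
  show "bracket_eq (sabr_W \<beta> n) (sabr_W \<beta> m) (\<lambda>x. (real n - real m) *\<^sub>R sabr_W \<beta> (n + m) x)" for n m
    using beta by (rule bracket_sabr_W)
  have span: "in_vf_span V (sabr_W \<beta>)"
    if "\<And>x. V x = c0 *\<^sub>R sabr_W \<beta> 0 x + c1 *\<^sub>R sabr_W \<beta> 1 x + c2 *\<^sub>R sabr_W \<beta> 2 x" for V c0 c1 c2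
    unfolding in_vf_span_def
    by (rule exI[of _ 2], rule exI[of _ "(!) [c0, c1, c2]"]) (simp add: that numeral_2_eq_2)
  fix i :: nat assume "i \<le> 2"
  then consider "i = 0" | "i = 1" | "i = 2" by linarith
  then show "in_vf_span (sabr_field \<beta> \<nu> \<rho> i) (sabr_W \<beta>)"
  proof cases
    case 1
    show ?thesis unfolding 1 by (rule span) (rule sabr_field_0_eq[OF beta rho])
  next
    case 2
    show ?thesis unfolding 2
      by (rule span[of _ "- \<nu> * \<rho>" "1 - \<beta>" 0]) (simp only: sabr_field_1_eq[OF beta], simp)
  next
    case 3
    show ?thesis unfolding 3
      by (rule span[of _ "- \<nu> * sqrt (1 - \<rho>\<^sup>2)" 0 0]) (simp only: sabr_field_2_eq, simp)
  qed
qed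

subsection \<open>Flows\<close>

lemma exp_flow_eqI:
  assumes "ode_solution W x u" and "\<And>v. ode_solution W x v \<Longrightarrow> v = u"
  shows "\<exists>!u. ode_solution W x u" and "exp_flow W t x = u t"
proof -
  show "\<exists>!u. ode_solution W x u" using assms by blast
  have "(THE u. ode_solution W x u) = u" using assms by blast
  then show "exp_flow W t x = u t" unfolding exp_flow_def by simp
qed

section \<open>Components of solutions and the scalar power equation\<close>

lemma has_vector_derivative_vector_2:
  assumes "(f has_real_derivative f') (at t)" "(g has_real_derivative g') (at t)"
  shows "((\<lambda>t. vector [f t, g t] :: real ^ 2) has_vector_derivative vector [f', g']) (at t)"
proof -
  have "((\<lambda>t. f t *\<^sub>R axis 1 1 + g t *\<^sub>R axis 2 1 :: real ^ 2) has_vector_derivative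
      (f t *\<^sub>R 0 + f' *\<^sub>R axis 1 1) + (g t *\<^sub>R 0 + g' *\<^sub>R axis 2 1)) (at t)"
    by (intro has_vector_derivative_add has_vector_derivative_scaleR assms has_vector_derivative_const)
  then show ?thesis by (simp add: vector_2_decompose)
qed

lemma has_real_derivative_nth:
  assumes "(u has_vector_derivative D) (at t)"
  shows "((\<lambda>s. u s $ i) has_real_derivative D $ i) (at t)"
  unfolding has_real_derivative_iff_has_vector_derivative
  by (rule bounded_linear.has_vector_derivative[OF bounded_linear_vec_nth assms])

text \<open>Continuity bridges the finitely many times at which an \<open>ode_solution\<close> may
  violate its equation; this is applied to quantities conserved along trajectories.\<close>

lemma constant_if_DERIV_0_off_finite:
  fixes f :: "real \<Rightarrow> real"
  assumes "continuous_on UNIV f" "finite E" "\<And>t. t \<notin> E \<Longrightarrow> (f has_real_derivative 0) (at t)"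
  shows "f s = f t"
proof (rule has_derivative_zero_unique_strong_convex[of UNIV E f t])
  show "(f has_derivative (\<lambda>h. 0)) (at x)" if "x \<in> UNIV - E" for x
    using assms(3)[of x] that by (simp add: has_field_derivative_def lambda_zero)
qed (use assms in auto)

text \<open>Since min(., 0) is 1-Lipschitz, its difference quotients are dominated by those of
  \<open>v\<close>, whatever the sign of \<open>v t\<close>.\<close>

lemma DERIV_min_0:
  fixes v :: "real \<Rightarrow> real"
  assumes "(v has_real_derivative 0) (at t)"
  shows "((\<lambda>s. min (v s) 0) has_real_derivative 0) (at t)"
proof -
  have lim: "((\<lambda>h. (v (t + h) - v t) / h) \<longlongrightarrow> 0) (at 0)"
    using assms by (simp add: DERIV_def)
  have "norm ((min (v (t + h)) 0 - min (v t) 0) / h) \<le> norm ((v (t + h) - v t) / h)" for h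
    unfolding norm_divide by (intro divide_right_mono) auto
  then have "eventually (\<lambda>h. norm ((min (v (t + h)) 0 - min (v t) 0) / h)
      \<le> norm ((v (t + h) - v t) / h)) (at 0)"
    by simp
  then have "((\<lambda>h. (min (v (t + h)) 0 - min (v t) 0) / h) \<longlongrightarrow> 0) (at 0)"
    using tendsto_norm_zero[OF lim] by (rule Lim_null_comparison)
  then show ?thesis by (simp add: DERIV_def)
qed

text \<open>While v > 0, the power v^a has derivative \<open>k\<close>, but positivity is known only
  at \<open>t0\<close>. An open-closed argument on the convex set \<open>S\<close>, where the affine
  function \<open>q\<close> is positive, propagates positivity and the formula together, forwards
  and backwards in time.\<close>

lemma positive_branch:
  fixes v :: "real \<Rightarrow> real"
  assumes a: "0 < a" and cont: "continuous_on UNIV v"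
    and deriv: "\<And>s. 0 < v s \<Longrightarrow> (v has_real_derivative k / a * v s powr (1 - a)) (at s)"
    and start: "0 < v t0" and pos: "0 < v t0 powr a + k * (t - t0)"
  shows "v t = (v t0 powr a + k * (t - t0)) powr (1 / a)"
proof -
  define q where "q s = v t0 powr a + k * (s - t0)" for s
  define S where "S = {s. 0 < q s}"
  define A where "A = S \<inter> (\<lambda>s. v s - q s powr (1 / a)) -` {0}"
  have qc: "continuous_on T q" for T unfolding q_def by (intro continuous_intros)
  have "convex S"
  proof (rule convexI)
    fix x y u w :: real
    assume *: "x \<in> S" "y \<in> S" "0 \<le> u" "0 \<le> w" "u + w = 1"
    then have w: "w = 1 - u" by simp
    have "q (u *\<^sub>R x + w *\<^sub>R y) = u * q x + w * q y"
      unfolding q_def w by (simp add: algebra_simps)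
    moreover have "0 < u * q x + w * q y"
    proof (cases "u = 0")
      case False
      then have "0 < u * q x" "0 \<le> w * q y" using * by (auto simp: S_def)
      then show ?thesis by simp
    qed (use * w in \<open>simp add: S_def\<close>)
    ultimately show "u *\<^sub>R x + w *\<^sub>R y \<in> S" by (simp add: S_def)
  qed
  then have "connected S" by (rule convex_connected)
  have "open S" unfolding S_def using qc by (intro open_Collect_less continuous_on_const)
  have "closedin (top_of_set S) A"
    unfolding A_def
  proof (rule continuous_closedin_preimage)
    show "continuous_on S (\<lambda>s. v s - q s powr (1 / a))"
      using continuous_on_subset[OF cont] qc
      by (intro continuous_on_diff continuous_on_powr continuous_on_const) (auto simp: S_def)
  qed simp
  \<comment> \<open>Near a time in \<open>A\<close> both \<open>v\<close> and \<open>q\<close> are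
    positive, so v^a - q is locally constant; its value, read off at that time, is 0.\<close>
  moreover have "open A"
  proof (rule openI)
    fix s assume s: "s \<in> A"
    then have "0 < q s" and vs: "v s = q s powr (1 / a)" by (auto simp: A_def S_def)
    then have "0 < v s" by simp
    have "open (S \<inter> {r. 0 < v r})"
      using \<open>open S\<close> cont by (intro open_Int open_Collect_less continuous_on_const)
    moreover have "s \<in> S \<inter> {r. 0 < v r}" using s \<open>0 < v s\<close> by (simp add: A_def)
    ultimately obtain e where e: "0 < e" "ball s e \<subseteq> S \<inter> {r. 0 < v r}"
      using open_contains_ball by metis
    have "((\<lambda>r. v r powr a - q r) has_real_derivative 0) (at r within ball s e)"
      if "r \<in> ball s e" for r
    proof -
      have r: "0 < v r" using that e by auto
      have "((\<lambda>r. v r powr a) has_real_derivative a * v r powr (a - 1) * (k / a * v r powr (1 - a))) (at r)"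
        using DERIV_chain2[OF has_real_derivative_powr[OF r] deriv[OF r]] .
      moreover have "a * v r powr (a - 1) * (k / a * v r powr (1 - a)) = k"
        using a r by (simp add: powr_diff field_simps)
      moreover have "(q has_real_derivative k) (at r)"
        unfolding q_def by (auto intro!: derivative_eq_intros)
      ultimately have "((\<lambda>r. v r powr a - q r) has_real_derivative k - k) (at r)"
        by (metis DERIV_diff)
      then show ?thesis by (simp add: has_field_derivative_at_within)
    qed
    then obtain c where c: "\<And>r. r \<in> ball s e \<Longrightarrow> v r powr a - q r = c"
      using has_field_derivative_zero_constant[OF convex_ball, of s e "\<lambda>r. v r powr a - q r"] by blast
    have "v s powr a = q s" unfolding vs powr_powr using a \<open>0 < q s\<close> by simp
    then have "c = 0" using c[of s] e by simp
    have "r \<in> A" if "r \<in> ball s e" for r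
    proof -
      have r: "0 < v r" "r \<in> S" using that e by auto
      have "q r = v r powr a" using c[OF that] \<open>c = 0\<close> by simp
      then have "q r powr (1 / a) = v r" using a r by (simp add: powr_powr)
      then show ?thesis using r by (simp add: A_def)
    qed
    then show "\<exists>e>0. ball s e \<subseteq> A" using e by blast
  qed
  then have "openin (top_of_set S) A" by (intro open_subset) (auto simp: A_def)
  moreover have "t0 \<in> A"
    using start a by (simp add: A_def S_def q_def powr_powr)
  ultimately have "A = S" using \<open>connected S\<close> unfolding connected_clopen by blast
  moreover have "t \<in> S" using pos by (simp add: S_def q_def)
  ultimately show ?thesis by (auto simp: A_def q_def)
qed

text \<open>Exceptional times are allowed only where v <= 0: \<open>deriv\<close> has no exceptions
  because the field is continuous where v > 0.\<close>

lemma power_ode_unique: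
  fixes v :: "real \<Rightarrow> real"
  assumes a: "0 < a" and cont: "continuous_on UNIV v" and E: "finite E"
    and deriv_off: "\<And>s. s \<notin> E \<Longrightarrow> (v has_real_derivative k / a * max (v s) 0 powr (1 - a)) (at s)"
    and deriv: "\<And>s. 0 < v s \<Longrightarrow> (v has_real_derivative k / a * v s powr (1 - a)) (at s)"
    and start: "0 < v 0"
  shows "v t = max (k * t + v 0 powr a) 0 powr (1 / a)"
proof (cases "0 < k * t + v 0 powr a")
  case True
  then show ?thesis
    using positive_branch[OF a cont deriv start, of t] by (simp add: add.commute)
next
  case False
  have "min (v t) 0 = min (v 0) 0"
  proof (rule constant_if_DERIV_0_off_finite[of "\<lambda>s. min (v s) 0" E])
    show "continuous_on UNIV (\<lambda>s. min (v s) 0)" by (intro continuous_intros cont)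
    fix s assume s: "s \<notin> E"
    show "((\<lambda>s. min (v s) 0) has_real_derivative 0) (at s)"
    proof (cases "0 < v s")
      case True
      have "open {r. 0 < v r}" using cont by (intro open_Collect_less continuous_on_const)
      then have "eventually (\<lambda>r. min (v r) 0 = 0) (nhds s)"
        using True by (intro eventually_mono[OF eventually_nhds_in_open[of "{r. 0 < v r}" s]]) auto
      then show ?thesis
        using DERIV_cong_ev[OF refl _ refl, of "\<lambda>r. min (v r) 0" "\<lambda>r. 0" s] by simp
    next
      case False
      \<comment> \<open>Here the right-hand side is a power of 0, hence 0, so \<open>v\<close>
        itself has derivative 0.\<close>
      then show ?thesis using deriv_off[OF s] by (intro DERIV_min_0) simp
    qed
  qed (rule E)
  then have nonneg: "0 \<le> v t" using start by simp
  moreover have "\<not> 0 < v t"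
  proof
    assume vt: "0 < v t"
    have vta: "0 < v t powr a" "0 < v 0 powr a" using vt start by simp_all
    moreover have "k * (0 - t) = - (k * t)" by simp
    \<comment> \<open>From k t <= - v(0)^a < 0 the branch through time \<open>t\<close> is still
      positive at time 0, so \<open>positive_branch\<close> applies with \<open>t\<close> as its
      starting time.\<close>
    ultimately have p: "0 < v t powr a + k * (0 - t)" using False by linarith
    have "v 0 = (v t powr a + k * (0 - t)) powr (1 / a)"
      by (rule positive_branch[OF a cont deriv vt p])
    then have "v 0 powr a = v t powr a + k * (0 - t)" using a p by (simp add: powr_powr)
    then have "k * t + v 0 powr a = v t powr a" by simp
    then show False using False vta by linarith
  qed
  ultimately show ?thesis using False by (simp add: max_def)
qed

lemma isCont_sabr_W:
  assumes "x$1 > 0"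
  shows "isCont (sabr_W \<beta> n) x"
proof (cases "n = 0")
  case True
  then have "sabr_W \<beta> n = (\<lambda>x. 0 *\<^sub>R axis 1 1 + (- (x$2)) *\<^sub>R axis 2 1)"
    by (simp add: fun_eq_iff sabr_W_def vector_2_decompose)
  then show ?thesis by (simp add: continuous_intros)
next
  case False
  define K where "K = 1 / (1 - \<beta>)"
  have W: "sabr_W \<beta> n = (\<lambda>x. (K * max (x$1) 0 powr (1 - real n * (1 - \<beta>)) * x$2 ^ n) *\<^sub>R axis 1 1
      + 0 *\<^sub>R axis 2 1)"
    using False by (simp add: fun_eq_iff sabr_W_def vector_2_decompose K_def)
  have c: "isCont (\<lambda>x::real^2. max (x$1) 0 powr (1 - real n * (1 - \<beta>))) x"
    using assms unfolding isCont_def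
    by (intro tendsto_powr tendsto_max tendsto_vec_nth tendsto_ident_at tendsto_const) auto
  show ?thesis unfolding W by (intro continuous_intros c)
qed

text \<open>With exponent <= 0 the power is at least 1 on (0, 1) but 0 at 0, also for exponent 0.
  This legitimizes the time at which the explicit flow fails to be differentiable.\<close>

lemma not_isCont_sabr_W:
  assumes "\<beta> < 1" "n \<ge> 1" "1 \<le> real n * (1 - \<beta>)" "y \<noteq> 0"
  shows "\<not> isCont (sabr_W \<beta> n) (vector [0, y])"
proof
  define C where "C = \<bar>1 / (1 - \<beta>) * y ^ n\<bar>"
  assume "isCont (sabr_W \<beta> n) (vector [0, y])"
  moreover have "((\<lambda>e. vector [e, y] :: real ^ 2) \<longlongrightarrow> vector [0, y]) (at_right 0)"
    unfolding vector_2_decompose by (intro tendsto_intros)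
  ultimately have "((\<lambda>e. sabr_W \<beta> n (vector [e, y])) \<longlongrightarrow> sabr_W \<beta> n (vector [0, y])) (at_right 0)"
    by (rule isCont_tendsto_compose)
  then have "((\<lambda>e. \<bar>sabr_W \<beta> n (vector [e, y]) $ 1\<bar>) \<longlongrightarrow> \<bar>sabr_W \<beta> n (vector [0, y]) $ 1\<bar>) (at_right 0)"
    by (intro tendsto_rabs tendsto_vec_nth)
  then have lim: "((\<lambda>e. \<bar>sabr_W \<beta> n (vector [e, y]) $ 1\<bar>) \<longlongrightarrow> 0) (at_right 0)"
    by (simp add: sabr_W_nth[OF assms(2)])
  have "C \<le> \<bar>sabr_W \<beta> n (vector [e, y]) $ 1\<bar>" if "0 < e" "e < 1" for e
  proof -
    have "1 powr (1 - real n * (1 - \<beta>)) \<le> e powr (1 - real n * (1 - \<beta>))"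
      using that assms by (intro powr_mono2') auto
    then have "C * 1 \<le> C * e powr (1 - real n * (1 - \<beta>))"
      by (intro mult_left_mono) (simp_all add: C_def)
    then show ?thesis
      using that assms by (simp add: sabr_W_nth C_def abs_mult mult.commute mult.left_commute)
  qed
  moreover have "eventually (\<lambda>e::real. 0 < e \<and> e < 1) (at_right 0)"
    using eventually_at_right_real[of 0 1] by simp
  ultimately have "C \<le> 0"
    by (intro tendsto_lowerbound[OF lim]) (auto elim: eventually_mono)
  moreover have "0 < C" using assms by (simp add: C_def)
  ultimately show False by simp
qed

text \<open>With x2 frozen, the first component g has to satisfy g' = (k/a) g^(1-a), that is (g^a)'
  = k wherever g > 0. The starting point is the value of the formula at time 0, which replaces x1 by
  its positive part.\<close>

lemma ode_solution_sabr_W_flow: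
  assumes beta: "\<beta> < 1" and n: "n \<ge> 1"
  shows "ode_solution (sabr_W \<beta> n) (vector [max (x$1) 0, x$2]) (\<lambda>t. sabr_W_flow \<beta> n t x)"
proof -
  define a k where "a = real n * (1 - \<beta>)" and "k = real n * x$2 ^ n"
  define q where "q t = k * t + max (x$1) 0 powr a" for t
  define g where "g t = max (q t) 0 powr (1 / a)" for t
  have a: "0 < a" using beta n by (simp add: a_def)
  have ka: "k / a = 1 / (1 - \<beta>) * x$2 ^ n" using n beta by (simp add: a_def k_def)
  have flow: "sabr_W_flow \<beta> n t x = vector [g t, x$2]" for t
    using n by (simp add: sabr_W_flow_def g_def q_def a_def k_def mult.commute mult.left_commute)
  have W: "sabr_W \<beta> n (vector [g t, x$2]) = vector [k / a * g t powr (1 - a), 0]" for t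
    using n by (simp add: sabr_W_def ka a_def[symmetric] g_def max_absorb1 mult.commute)
  have q': "(q has_real_derivative k) (at t)" for t
    unfolding q_def by (auto intro!: derivative_eq_intros)
  \<comment> \<open>Only a zero of \<open>q\<close> is critical. There a < 1 makes the outer
    exponent 1/a exceed 1, so the power is differentiable at 0, while k = 0 makes the curve
    constant.\<close>
  have good: "((\<lambda>t. sabr_W_flow \<beta> n t x) has_vector_derivative sabr_W \<beta> n (sabr_W_flow \<beta> n t x)) (at t)"
    if t: "q t \<noteq> 0 \<or> a < 1 \<or> k = 0" for t
  proof -
    have "(g has_real_derivative k / a * g t powr (1 - a)) (at t)"
    proof (cases "k = 0")
      case True
      then have "g = (\<lambda>_. g 0)" by (simp add: g_def q_def fun_eq_iff)
      then show ?thesis using True DERIV_const[of "g 0"] by simp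
    next
      case False
      with t a have "q t \<noteq> 0 \<or> 1 < 1 / a" by auto
      from DERIV_chain2[OF DERIV_max_powr[OF this] q']
      have "(g has_real_derivative 1 / a * max (q t) 0 powr (1 / a - 1) * k) (at t)"
        unfolding g_def .
      moreover have "g t powr (1 - a) = max (q t) 0 powr (1 / a - 1)"
        using a by (simp add: g_def powr_powr diff_divide_distrib)
      ultimately show ?thesis by (simp add: mult.commute)
    qed
    then show ?thesis unfolding flow W
      by (intro has_vector_derivative_vector_2) auto
  qed
  show ?thesis
    unfolding ode_solution_def
  proof (intro conjI allI impI)
    show "sabr_W_flow \<beta> n 0 x = vector [max (x$1) 0, x$2]"
      unfolding flow using a by (simp add: g_def q_def powr_powr)
    have "continuous_on UNIV g"
      unfolding g_def q_def using a by (intro continuous_on_powr' continuous_intros) auto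
    then show "continuous_on UNIV (\<lambda>t. sabr_W_flow \<beta> n t x)"
      unfolding flow vector_2_decompose by (intro continuous_intros)
  next
    fix t assume cont: "isCont (sabr_W \<beta> n) (sabr_W_flow \<beta> n t x)"
    \<comment> \<open>Otherwise the curve is at (0, x2) with x2 \<noteq> 0 and a >= 1, where the
      field is discontinuous.\<close>
    have "q t \<noteq> 0 \<or> a < 1 \<or> k = 0"
    proof (rule ccontr)
      assume "\<not> ?thesis"
      then have "q t = 0" "1 \<le> a" "x$2 \<noteq> 0" using n by (auto simp: k_def)
      then have "g t = 0" by (simp add: g_def)
      with cont not_isCont_sabr_W[OF beta n] \<open>1 \<le> a\<close> \<open>x$2 \<noteq> 0\<close> show False
        unfolding flow a_def by simp
    qed
    then show "((\<lambda>t. sabr_W_flow \<beta> n t x) has_vector_derivative sabr_W \<beta> n (sabr_W_flow \<beta> n t x)) (at t)"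
      by (rule good)
  next
    have "{s. \<not> ((\<lambda>t. sabr_W_flow \<beta> n t x) has_vector_derivative sabr_W \<beta> n (sabr_W_flow \<beta> n s x)) (at s)}
        \<subseteq> {- (max (x$1) 0 powr a) / k}"
    proof
      fix s assume "s \<in> {s. \<not> ((\<lambda>t. sabr_W_flow \<beta> n t x) has_vector_derivative sabr_W \<beta> n (sabr_W_flow \<beta> n s x)) (at s)}"
      then have "q s = 0" "k \<noteq> 0" using good[of s] by auto
      then show "s \<in> {- (max (x$1) 0 powr a) / k}" by (simp add: q_def field_simps)
    qed
    then show "finite {s. \<not> ((\<lambda>t. sabr_W_flow \<beta> n t x) has_vector_derivative sabr_W \<beta> n (sabr_W_flow \<beta> n s x)) (at s)}"
      using finite_subset by blast
  qed
qed

lemma ode_solution_sabr_W_unique: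
  assumes beta: "\<beta> < 1" and n: "n \<ge> 1" and x: "x$1 > 0" and u: "ode_solution (sabr_W \<beta> n) x u"
  shows "u = (\<lambda>t. sabr_W_flow \<beta> n t x)"
proof
  fix t
  define E where "E = {s. \<not> (u has_vector_derivative sabr_W \<beta> n (u s)) (at s)}"
  define a k where "a = real n * (1 - \<beta>)" and "k = real n * x$2 ^ n"
  have a: "0 < a" using beta n by (simp add: a_def)
  have ka: "k / a = 1 / (1 - \<beta>) * x$2 ^ n" using n beta by (simp add: a_def k_def)
  have u0: "u 0 = x" and cont: "continuous_on UNIV u" and E: "finite E"
    and sol: "\<And>s. isCont (sabr_W \<beta> n) (u s) \<Longrightarrow> s \<notin> E"
    using u by (auto simp: ode_solution_def E_def)
  have D: "((\<lambda>s. u s $ i) has_real_derivative sabr_W \<beta> n (u s) $ i) (at s)" if "s \<notin> E" for s i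
    using that has_real_derivative_nth unfolding E_def by blast
  have u2: "u s $ 2 = x$2" for s
  proof -
    have "u s $ 2 = u 0 $ 2"
    proof (rule constant_if_DERIV_0_off_finite[of "\<lambda>s. u s $ 2" E])
      show "continuous_on UNIV (\<lambda>s. u s $ 2)" by (intro continuous_intros cont)
      show "((\<lambda>s. u s $ 2) has_real_derivative 0) (at t)" if "t \<notin> E" for t
        using D[OF that, of 2] by (simp add: sabr_W_nth[OF n])
    qed (rule E)
    then show ?thesis by (simp add: u0)
  qed
  have D1: "((\<lambda>s. u s $ 1) has_real_derivative k / a * max (u s $ 1) 0 powr (1 - a)) (at s)"
    if "s \<notin> E" for s
    using D[OF that, of 1] by (simp add: sabr_W_nth[OF n] u2 ka a_def[symmetric] ac_simps)
  have "u t $ 1 = max (k * t + u 0 $ 1 powr a) 0 powr (1 / a)"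
  proof (rule power_ode_unique[of a "\<lambda>s. u s $ 1" E])
    show "continuous_on UNIV (\<lambda>s. u s $ 1)" by (intro continuous_intros cont)
    show "((\<lambda>s. u s $ 1) has_real_derivative k / a * u s $ 1 powr (1 - a)) (at s)"
      if "0 < u s $ 1" for s
      \<comment> \<open>Continuity of the field at x1 > 0 excludes such times from
        \<open>E\<close>.\<close>
      using D1[OF sol[OF isCont_sabr_W[OF that]]] that by simp
  qed (use a E D1 u0 x in auto)
  then show "u t = sabr_W_flow \<beta> n t x"
    using n x by (simp add: vec_eq_iff forall_2 sabr_W_flow_def u0 u2 a_def k_def ac_simps)
qed

lemma sabr_W_flow_solves_uniquely:
  assumes "\<beta> < 1" "n \<ge> 1" "x$1 > 0"
  shows "\<exists>!u. ode_solution (sabr_W \<beta> n) x u"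
    and "exp_flow (sabr_W \<beta> n) t x = sabr_W_flow \<beta> n t x"
proof -
  have "(vector [max (x$1) 0, x$2] :: real ^ 2) = x"
    using assms(3) by (simp add: vec_eq_iff forall_2)
  with ode_solution_sabr_W_flow[OF assms(1,2), of x]
  have sol: "ode_solution (sabr_W \<beta> n) x (\<lambda>t. sabr_W_flow \<beta> n t x)" by simp
  show "\<exists>!u. ode_solution (sabr_W \<beta> n) x u"
    and "exp_flow (sabr_W \<beta> n) t x = sabr_W_flow \<beta> n t x"
    using exp_flow_eqI[OF sol] ode_solution_sabr_W_unique[OF assms] by blast+
qed

lemma sabr_W_0_flow_solves_uniquely:
  shows "\<exists>!u. ode_solution (sabr_W \<beta> 0) x u"
    and "exp_flow (sabr_W \<beta> 0) t x = sabr_W_flow \<beta> 0 t x"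
proof -
  have W: "sabr_W \<beta> 0 = (\<lambda>x. 0 *\<^sub>R axis 1 1 + (- (x$2)) *\<^sub>R axis 2 1)"
    by (simp add: fun_eq_iff sabr_W_def vector_2_decompose)
  have cont: "isCont (sabr_W \<beta> 0) y" for y
    unfolding W by (intro continuous_intros)
  have flow: "sabr_W_flow \<beta> 0 t x = vector [x$1, x$2 * exp (- t)]" for t
    by (simp add: sabr_W_flow_def)
  have D: "((\<lambda>t. sabr_W_flow \<beta> 0 t x) has_vector_derivative sabr_W \<beta> 0 (sabr_W_flow \<beta> 0 t x)) (at t)" for t
    unfolding flow sabr_W_def
    by (simp, intro has_vector_derivative_vector_2) (auto intro!: derivative_eq_intros)
  then have "continuous_on UNIV (\<lambda>t. sabr_W_flow \<beta> 0 t x)"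
    by (intro continuous_at_imp_continuous_on) (blast intro: has_vector_derivative_continuous)
  then have sol: "ode_solution (sabr_W \<beta> 0) x (\<lambda>t. sabr_W_flow \<beta> 0 t x)"
    unfolding ode_solution_def using D by (simp add: flow vec_eq_iff forall_2)
  have uniq: "u = (\<lambda>t. sabr_W_flow \<beta> 0 t x)" if u: "ode_solution (sabr_W \<beta> 0) x u" for u
  proof
    fix t
    have u0: "u 0 = x" and uc: "continuous_on UNIV u"
      and Du: "((\<lambda>s. u s $ i) has_real_derivative sabr_W \<beta> 0 (u s) $ i) (at s)" for s i
      using u cont has_real_derivative_nth unfolding ode_solution_def by blast+
    have "u t $ 1 = u 0 $ 1"
    proof (rule constant_if_DERIV_0_off_finite[of "\<lambda>s. u s $ 1" "{}"])
      show "continuous_on UNIV (\<lambda>s. u s $ 1)" by (intro continuous_intros uc)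
      show "((\<lambda>s. u s $ 1) has_real_derivative 0) (at s)" for s using Du[of 1 s] by simp
    qed simp
    \<comment> \<open>Integrating factor for the linear equation u2' = - u2.\<close>
    moreover have "u t $ 2 * exp t = u 0 $ 2 * exp 0"
    proof (rule constant_if_DERIV_0_off_finite[of "\<lambda>s. u s $ 2 * exp s" "{}"])
      show "continuous_on UNIV (\<lambda>s. u s $ 2 * exp s)" by (intro continuous_intros uc)
      show "((\<lambda>s. u s $ 2 * exp s) has_real_derivative 0) (at s)" for s
        using DERIV_mult[OF Du[of 2 s] DERIV_exp[of s]] by (simp add: mult.commute)
    qed simp
    then have "u t $ 2 = x$2 * exp (- t)" by (simp add: u0 exp_minus field_simps)
    ultimately show "u t = sabr_W_flow \<beta> 0 t x" by (simp add: flow vec_eq_iff forall_2 u0)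
  qed
  show "\<exists>!u. ode_solution (sabr_W \<beta> 0) x u"
    and "exp_flow (sabr_W \<beta> 0) t x = sabr_W_flow \<beta> 0 t x"
    using exp_flow_eqI[OF sol uniq] by blast+
qed

text \<open>For x1 = 0 the constant curve is also a solution, and for x1 < 0 the explicit curve does
  not start at x, so \<open>exp_flow\<close> is not taken at x itself. It is taken at (\<epsilon>,
  x2) with \<epsilon> > 0, where solutions are unique, and the formula is continuous up to
  \<epsilon> = 0 because \<open>a\<close> and 1/a are positive.\<close>

lemma sabr_W_flow_critical_limit:
  assumes beta: "\<beta> < 1" and n: "n \<ge> 1" and x: "x$1 \<le> 0"
  shows "((\<lambda>\<epsilon>. exp_flow (sabr_W \<beta> n) t (vector [max (x$1) 0 + \<epsilon>, x$2]))
    \<longlongrightarrow> sabr_W_flow \<beta> n t x) (at_right 0)"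
proof -
  define a where "a = real n * (1 - \<beta>)"
  have a: "0 < a" using beta n by (simp add: a_def)
  have "((\<lambda>\<epsilon>::real. max \<epsilon> 0 powr a) \<longlongrightarrow> max 0 0 powr a) (at_right 0)"
    using a by (intro tendsto_powr' tendsto_intros) auto
  then have lim: "((\<lambda>\<epsilon>::real. max \<epsilon> 0 powr a) \<longlongrightarrow> max (x$1) 0 powr a) (at_right 0)"
    using x by (simp add: max_def)
  have "((\<lambda>\<epsilon>. max (real n * x$2 ^ n * t + max \<epsilon> 0 powr a) 0 powr (1 / a)) \<longlongrightarrow>
      max (real n * x$2 ^ n * t + max (x$1) 0 powr a) 0 powr (1 / a)) (at_right 0)"
    using a by (intro tendsto_powr'[OF tendsto_max[OF tendsto_add[OF tendsto_const lim] tendsto_const] tendsto_const]) auto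
  then have "((\<lambda>\<epsilon>. sabr_W_flow \<beta> n t (vector [\<epsilon>, x$2])) \<longlongrightarrow> sabr_W_flow \<beta> n t x) (at_right 0)"
    using n unfolding sabr_W_flow_def a_def vector_2_decompose by (auto intro!: tendsto_intros)
  moreover have "eventually (\<lambda>\<epsilon>. sabr_W_flow \<beta> n t (vector [\<epsilon>, x$2])
      = exp_flow (sabr_W \<beta> n) t (vector [max (x$1) 0 + \<epsilon>, x$2])) (at_right 0)"
    using x by (intro eventually_mono[OF eventually_at_right_less[of 0]])
      (simp add: sabr_W_flow_solves_uniquely(2)[OF beta n])
  ultimately show ?thesis by (rule Lim_transform_eventually)
qed

theorem mainTheorem2:
  fixes \<beta> \<nu> \<rho> :: real
  assumes beta: "1/2 < \<beta>" "\<beta> < 1"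
    and rho: "\<bar>\<rho>\<bar> \<le> 1"
  shows
    "(\<forall>n m. bracket_eq (sabr_W \<beta> n) (sabr_W \<beta> m)
              (\<lambda>x. (real n - real m) *\<^sub>R sabr_W \<beta> (n + m) x))
     \<and>
     ((\<forall>x. sabr_field \<beta> \<nu> \<rho> 0 x =
              (1/2 * \<nu>\<^sup>2) *\<^sub>R sabr_W \<beta> 0 x
              + (1/2 * (\<beta> - 1) * \<nu> * \<rho>) *\<^sub>R sabr_W \<beta> 1 x
              + (1/2 * \<beta> * (\<beta> - 1)) *\<^sub>R sabr_W \<beta> 2 x) \<and>
      (\<forall>x. sabr_field \<beta> \<nu> \<rho> 1 x =
              (- \<nu> * \<rho>) *\<^sub>R sabr_W \<beta> 0 x + (1 - \<beta>) *\<^sub>R sabr_W \<beta> 1 x) \<and>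
      (\<forall>x. sabr_field \<beta> \<nu> \<rho> 2 x = (- \<nu> * sqrt (1 - \<rho>\<^sup>2)) *\<^sub>R sabr_W \<beta> 0 x) \<and>
      witt_condition 2 (sabr_field \<beta> \<nu> \<rho>))
     \<and>
     ((\<forall>x. (\<exists>!u. ode_solution (sabr_W \<beta> 0) x u) \<and>
           (\<forall>t. exp_flow (sabr_W \<beta> 0) t x = sabr_W_flow \<beta> 0 t x)) \<and>
      (\<forall>n\<ge>1. \<forall>x. x$1 > 0 \<longrightarrow>
           (\<exists>!u. ode_solution (sabr_W \<beta> n) x u) \<and>
           (\<forall>t. exp_flow (sabr_W \<beta> n) t x = sabr_W_flow \<beta> n t x)) \<and>
      \<comment> \<open>On the critical line \<open>x1 = 0\<close> solutions need not be unique and for \<open>x1 < 0\<close> the flow is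
          extended through \<open>max x1 0\<close>: the extension is the limit of the flows from the interior,
          and it is again a solution.\<close>
      (\<forall>n\<ge>1. \<forall>x. x$1 \<le> 0 \<longrightarrow>
           ode_solution (sabr_W \<beta> n) (vector [max (x$1) 0, x$2]) (\<lambda>t. sabr_W_flow \<beta> n t x) \<and>
           (\<forall>t. ((\<lambda>\<epsilon>. exp_flow (sabr_W \<beta> n) t (vector [max (x$1) 0 + \<epsilon>, x$2]))
                    \<longlongrightarrow> sabr_W_flow \<beta> n t x) (at_right 0))))"
proof (intro conjI allI impI)
  show "bracket_eq (sabr_W \<beta> n) (sabr_W \<beta> m) (\<lambda>x. (real n - real m) *\<^sub>R sabr_W \<beta> (n + m) x)" for n m
    using beta(2) by (rule bracket_sabr_W)
qed (rule sabr_field_0_eq[OF beta(2) rho] sabr_field_1_eq[OF beta(2)] sabr_field_2_eq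
    witt_condition_sabr[OF beta(2) rho] sabr_W_0_flow_solves_uniquely
    sabr_W_flow_solves_uniquely[OF beta(2)] ode_solution_sabr_W_flow[OF beta(2)]
    sabr_W_flow_critical_limit[OF beta(2)]; assumption)+

end
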